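(* Let $X$ be a Banach space, suppose that a family of subspaces $\{A_j\}$ of $X$ defines the approximation space $A^{r,q}(X)$ with $r>0$ and $1\le q\le\infty$, and set $n_j:=\dim A_j$. Suppose that $\{\tilde\Pi_j\}_{j\in\mathbb{N}}$ is a family of uniformly bounded linear projection operators $\tilde\Pi_j:X\to A_j$ that are onto $A_j$ for each $j\in\mathbb{N}$. When $\{n_j\}_{j\in\mathbb{N}}$ is a quasigeometric sequence, we have $$\|(I-\tilde\Pi_{n_j})f\|_X\lesssim n_j^{-r}\,\|f\|_{A^{r,q}(X)}$$ and $$\left|\langle (I-\tilde\Pi_{n_j}')\nu,f\rangle_{X^*\times X}\right|\lesssim n_j^{-r}\,\|\nu\|_{X^*}\,\|f\|_{A^{r,q}(X)}$$ for all $j\in\mathbb{N}$, $\nu\in X^*$, and $f\in A^{r,q}(X)$.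
   Context: The approximant subspaces $\{A_n\}_{n\in\mathbb{N}_0}$ are finite dimensional linear subspaces of $X$ with $\{0\}=A_0\subseteq A_1\subseteq A_2\subseteq\dots\subseteq X$ and $\bigcup_nA_n$ dense in $X$. With $E_n(f,X):=\inf_{a\in A_n}\|f-a\|_X$, the approximation space is $A^{r,q}(X):=\{f\in X\mid \|f\|_{A^{r,q}(X)}<\infty\}$, where $$\|f\|_{A^{r,q}(X)}:=\Big(\sum_{n=1}^\infty\big[n^rE_{n-1}(f,X)\big]^q\tfrac1n\Big)^{1/q}\ (1\le q<\infty),\qquad \|f\|_{A^{r,\infty}(X)}:=\sup_{n\ge1}n^rE_{n-1}(f,X).$$ A sequence of positive integers $\{n_j\}$ is quasigeometric if there are constants $a,b$ with $1<a\le n_{j+1}/n_j\le b<\infty$ for all $j$. $\tilde\Pi_n':X^*\to X^*$ is the Banach space transpose of $\tilde\Pi_n$ (regarded as an operator into $X$): $\langle\tilde\Pi_n'\nu,f\rangle_{X^*\times X}=\langle\nu,\tilde\Pi_nf\rangle_{X^*\times X}$. Uniformly bounded means $\sup_n\|\tilde\Pi_n\|_{\mathcal{L}(X)}<\infty$. $a\lesssim b$ means $a\le c\,b$ with a constant $c>0$ independent of $j,f,\nu$. *)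

theory Defs
  imports "HOL-Analysis.Analysis"
begin

(* Banach spaces over the real or complex field.  By Gelfand-Mazur the fields in the class
   real_normed_field are, up to isomorphism, the reals and the complex numbers only; over the
   reals, smul can only be the built-in scaleR (assumption smul_of_real). *)

locale banach_over = vector_space smul
  for smul :: "'k::real_normed_field \<Rightarrow> 'a::banach \<Rightarrow> 'a" +
  assumes smul_of_real: "smul (of_real t) x = t *\<^sub>R x"
    and norm_smul: "norm (smul c x) = norm c * norm x"

lemma banach_over_scaleR: "banach_over ((*\<^sub>R) :: real \<Rightarrow> 'a::banach \<Rightarrow> 'a)"
  by unfold_locales (simp_all add: algebra_simps)

locale approximant_subspaces = banach_over smul
  for smul :: "'k::real_normed_field \<Rightarrow> 'a::banach \<Rightarrow> 'a" +
  fixes A :: "nat \<Rightarrow> 'a set"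
  assumes A_0: "A 0 = {0}"
    and A_Suc: "A n \<subseteq> A (Suc n)"
    and subspace_A: "subspace (A n)"
    and finite_dim_A: "\<exists>B. finite B \<and> span B = A n"
    and dense_A: "closure (\<Union>n. A n) = UNIV"

definition approx_error :: "(nat \<Rightarrow> 'a::real_normed_vector set) \<Rightarrow> nat \<Rightarrow> 'a \<Rightarrow> real"
  where "approx_error A n f = (INF a\<in>A n. norm (f - a))"

(* intended for exponents p > 0 *)
definition ennreal_powr :: "ennreal \<Rightarrow> real \<Rightarrow> ennreal"
  where "ennreal_powr x p = (if x = \<infinity> then \<infinity> else ennreal (enn2real x powr p))"

(* The index n is shifted by one: n of the usual definition is Suc n here.
   The exponent q ranges over the extended reals between 1 and infinity. *)
definition approx_norm ::
    "(nat \<Rightarrow> 'a::real_normed_vector set) \<Rightarrow> real \<Rightarrow> ennreal \<Rightarrow> 'a \<Rightarrow> ennreal"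
  where "approx_norm A r q f =
    (if q = \<infinity>
     then SUP n. ennreal (real (Suc n) powr r * approx_error A n f)
     else ennreal_powr
       (\<Sum>n. ennreal ((real (Suc n) powr r * approx_error A n f) powr enn2real q / real (Suc n)))
       (1 / enn2real q))"

definition approx_space ::
    "(nat \<Rightarrow> 'a::real_normed_vector set) \<Rightarrow> real \<Rightarrow> ennreal \<Rightarrow> 'a set"
  where "approx_space A r q = {f. approx_norm A r q f < \<infinity>}"

(* Sequences are indexed by j = 1, 2, ...; the value at 0 is irrelevant. *)
definition quasigeometric :: "(nat \<Rightarrow> nat) \<Rightarrow> bool"
  where "quasigeometric m \<longleftrightarrow> (\<forall>j\<ge>1. 0 < m j) \<and>
    (\<exists>a b :: real. 1 < a \<and> (\<forall>j\<ge>1. a \<le> real (m (Suc j)) / real (m j) \<and>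
                                      real (m (Suc j)) / real (m j) \<le> b))"

(* The function type of bounded operators only provides real linearity, hence the explicit
   homogeneity conditions over 'k below. *)

definition projection_onto ::
    "('k \<Rightarrow> 'a::real_normed_vector \<Rightarrow> 'a) \<Rightarrow> ('a \<Rightarrow>\<^sub>L 'a) \<Rightarrow> 'a set \<Rightarrow> bool"
  where "projection_onto smul P V \<longleftrightarrow>
    (\<forall>c x. P (smul c x) = smul c (P x)) \<and> P o\<^sub>L P = P \<and> range (blinfun_apply P) = V"

definition dual_space ::
    "('k::real_normed_field \<Rightarrow> 'a::real_normed_vector \<Rightarrow> 'a) \<Rightarrow> ('a \<Rightarrow>\<^sub>L 'k) set"
  where "dual_space smul = {\<nu> :: 'a \<Rightarrow>\<^sub>L 'k. \<forall>c x. \<nu> (smul c x) = c * \<nu> x}"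

lift_definition banach_transpose ::
    "('a::real_normed_vector \<Rightarrow>\<^sub>L 'b::real_normed_vector) \<Rightarrow>
     ('b \<Rightarrow>\<^sub>L 'k::real_normed_field) \<Rightarrow>\<^sub>L ('a \<Rightarrow>\<^sub>L 'k)"
  is "\<lambda>T \<nu>. \<nu> o\<^sub>L T"
  by (rule bounded_bilinear.bounded_linear_left[OF bounded_bilinear_blinfun_compose])

lemma banach_transpose_apply: "banach_transpose T \<nu> f = \<nu> (T f)"
  by (simp add: banach_transpose.rep_eq)

lemma banach_transpose_in_dual_space:
  assumes "projection_onto smul P V" "\<nu> \<in> dual_space smul"
  shows "banach_transpose P \<nu> \<in> dual_space smul"
  using assms by (simp add: projection_onto_def dual_space_def banach_transpose_apply)

end

theory Submission
  imports Defs
begin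

text \<open>
  Both estimates come from two independent facts. A bounded projection onto a subspace is
  quasi-optimal (Lebesgue's lemma): it reproduces every \<open>a\<close> in its range, so
  \<open>f - P f = (I - P) (f - a)\<close>, and taking the infimum over \<open>a\<close> bounds the projection error by
  \<open>1 + \<parallel>P\<parallel>\<close> times the best-approximation error \<open>E\<^sub>m(f)\<close>
  (\<open>projection_error_le_approx_error\<close>). On the other hand finiteness of the
  \<open>A\<^sup>r\<^sup>,\<^sup>q\<close> norm forces \<open>E\<^sub>m(f)\<close> to decay like \<open>m\<^sup>-\<^sup>r\<close> (\<open>approx_error_decay\<close>). For infinite
  \<open>q\<close> this is the definition of the norm. For finite \<open>q\<close> a single term of the series only yields
  \<open>m\<^sup>-\<^sup>r\<^sup>+\<^sup>1\<^sup>/\<^sup>q\<close>, so monotonicity of the errors is used: all terms of index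
  between \<open>m/2\<close> and \<open>m\<close> have, up to a constant, at least the value \<open>m\<^sup>r E\<^sub>m(f)\<close> under the \<open>q\<close>-th
  power, and the weights \<open>1/k\<close> of this block add up to at least \<open>1/2\<close>.

  The operator \<open>\<Pi>\<close> of index \<open>n\<^sub>j\<close> has range \<open>A m\<close> with \<open>m = n\<^sub>j\<close>, so the two facts are applied
  with this \<open>m\<close>; uniform boundedness makes \<open>1 + \<parallel>P\<parallel>\<close> independent of \<open>j\<close>. The dual estimate is the
  primal one after moving the transpose to the other side of the duality pairing.
\<close>

lemma bdd_below_norm_diff: "bdd_below ((\<lambda>a. norm (f - a)) ` S)"
  by (rule bdd_belowI2[of _ 0]) simp

lemma approx_error_nonneg:
  assumes "A m \<noteq> {}"
  shows "0 \<le> approx_error A m f"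
  unfolding approx_error_def using assms by (intro cINF_greatest) auto

lemma approx_error_antimono:
  assumes "mono A" "A 0 \<noteq> {}"
  shows "antimono (\<lambda>m. approx_error A m f)"
proof
  fix k m :: nat
  assume "k \<le> m"
  moreover have "A 0 \<subseteq> A k" using assms(1) by (simp add: mono_def)
  ultimately show "approx_error A m f \<le> approx_error A k f"
    unfolding approx_error_def using assms
    by (intro cINF_superset_mono bdd_below_norm_diff) (auto dest: monoD)
qed

text \<open>The dyadic block \<open>{m div 2..m}\<close> carries the estimate: it has at least \<open>(m + 1)/2\<close> elements,
  each with weight \<open>1/(k + 1) \<ge> 1/(m + 1)\<close>, and on it the factor \<open>(k + 1)\<^sup>r E k\<close> loses at most
  \<open>2\<^sup>r\<close> against its value at \<open>m\<close>.\<close>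

lemma weighted_block_lower_bound:
  fixes E :: "nat \<Rightarrow> real"
  assumes "antimono E" "\<And>k. 0 \<le> E k" "0 \<le> r" "0 \<le> p"
  shows "((real (Suc m) / 2) powr r * E m) powr p / 2
    \<le> (\<Sum>k\<le>m. (real (Suc k) powr r * E k) powr p / real (Suc k))"
proof -
  let ?T = "((real (Suc m) / 2) powr r * E m) powr p"
  have "?T / 2 = (real (Suc m) / 2) * (?T / real (Suc m))"
    by (simp del: of_nat_Suc)
  also have "\<dots> \<le> real (card {m div 2..m}) * (?T / real (Suc m))"
    by (intro mult_right_mono) (auto simp: field_simps)
  also have "\<dots> = (\<Sum>k\<in>{m div 2..m}. ?T / real (Suc m))"
    by simp
  also have "\<dots> \<le> (\<Sum>k\<in>{m div 2..m}. (real (Suc k) powr r * E k) powr p / real (Suc k))"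
  proof (rule sum_mono)
    fix k assume k: "k \<in> {m div 2..m}"
    then have "real (Suc m) / 2 \<le> real (Suc k)"
      by auto
    moreover have "E m \<le> E k"
      using k assms(1) by (auto dest: antimonoD)
    ultimately have "?T \<le> (real (Suc k) powr r * E k) powr p"
      using assms by (intro powr_mono2 mult_mono) auto
    then show "?T / real (Suc m) \<le> (real (Suc k) powr r * E k) powr p / real (Suc k)"
      using k by (intro frac_le) auto
  qed
  also have "\<dots> \<le> (\<Sum>k\<le>m. (real (Suc k) powr r * E k) powr p / real (Suc k))"
    by (intro sum_mono2) auto
  finally show ?thesis .
qed

text \<open>A \<open>q\<close>-th root turns the factor \<open>1/2\<close> of the block estimate into \<open>2\<^sup>-\<^sup>1\<^sup>/\<^sup>q \<ge> 1/2\<close>; together with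
  the loss \<open>2\<^sup>r\<close> this gives a constant that serves all \<open>q\<close> at once.\<close>

lemma approx_error_decay:
  assumes "mono A" "A 0 \<noteq> {}" "0 \<le> r" "1 \<le> q" and f: "f \<in> approx_space A r q"
  shows "real (Suc m) powr r * approx_error A m f
    \<le> 2 powr (1 + r) * enn2real (approx_norm A r q f)"
proof -
  define E where "E k = approx_error A k f" for k
  let ?N = "enn2real (approx_norm A r q f)"
  have anti: "antimono E"
    unfolding E_def using assms(1,2) by (rule approx_error_antimono)
  have ne: "A k \<noteq> {}" for k
    using assms(1,2) monoD[of A 0 k] by auto
  have E0: "0 \<le> E k" for k
    unfolding E_def using ne by (rule approx_error_nonneg)
  have fin: "approx_norm A r q f < \<infinity>"
    using f by (simp add: approx_space_def)
  show ?thesis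
  proof (cases "q = \<infinity>")
    case True
    then have "ennreal (real (Suc m) powr r * E m) \<le> approx_norm A r q f"
      unfolding approx_norm_def E_def by (auto intro: SUP_upper)
    then have "real (Suc m) powr r * E m \<le> ?N"
      using enn2real_mono[OF _ fin[unfolded infinity_ennreal_def]] E0[of m] by fastforce
    also have "\<dots> \<le> 2 powr (1 + r) * ?N"
      using mult_right_mono[of 1 "2 powr (1 + r)" ?N] ge_one_powr_ge_zero[of 2 "1 + r"] assms(3)
      by simp
    finally show ?thesis by (simp add: E_def)
  next
    case False
    define p where "p = enn2real q"
    define u where "u k = (real (Suc k) powr r * E k) powr p / real (Suc k)" for k
    define S where "S = (\<Sum>k. ennreal (u k))"
    have p: "1 \<le> p"
      unfolding p_def using enn2real_mono[OF assms(4)] False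
      by (simp add: top.not_eq_extremum)
    have norm_eq: "approx_norm A r q f = ennreal_powr S (1 / p)"
      using False by (simp add: approx_norm_def S_def u_def E_def p_def)
    then have S: "S \<noteq> \<infinity>"
      using fin by (auto simp: ennreal_powr_def)
    then have N: "?N = enn2real S powr (1 / p)"
      by (simp add: norm_eq ennreal_powr_def)
    have u0: "0 \<le> u k" for k
      by (simp add: u_def)
    let ?t = "(real (Suc m) / 2) powr r * E m"
    have "(\<Sum>k\<le>m. ennreal (u k)) \<le> S"
      unfolding S_def by (intro sum_le_suminf) auto
    then have "ennreal (\<Sum>k\<le>m. u k) \<le> S"
      using u0 by (simp add: sum_ennreal)
    then have "(\<Sum>k\<le>m. u k) \<le> enn2real S"
      using enn2real_mono[of _ S] S u0
      by (fastforce simp: top.not_eq_extremum sum_nonneg)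
    moreover have "?t powr p / 2 \<le> (\<Sum>k\<le>m. u k)"
      unfolding u_def using anti E0 assms(3) p by (intro weighted_block_lower_bound) auto
    ultimately have "?t powr p / 2 \<le> enn2real S"
      by simp
    then have root: "(?t powr p / 2) powr (1 / p) \<le> ?N"
      unfolding N using p by (intro powr_mono2) auto
    have root_eq: "(x powr p / 2) powr (1 / p) = x / 2 powr (1 / p)" if "0 \<le> x" for x
      using p that by (simp add: powr_divide powr_powr)
    have "?t / 2 \<le> ?t / 2 powr (1 / p)"
    proof (rule divide_left_mono)
      show "(2::real) powr (1 / p) \<le> 2"
        using powr_mono[of "1 / p" 1 "2::real"] p by simp
    qed (use E0 in auto)
    also have "\<dots> = (?t powr p / 2) powr (1 / p)"
      using E0 by (intro root_eq[symmetric]) simp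
    also note root
    finally have "?t / 2 \<le> ?N" .
    then show ?thesis
      by (simp add: E_def powr_divide powr_add field_simps)
  qed
qed

text \<open>\<open>I - P\<close> annihilates \<open>A m\<close>, so \<open>f\<close> may be replaced by \<open>f - a\<close> for any \<open>a\<close> in \<open>A m\<close>.\<close>

lemma projection_error_le_approx_error:
  assumes "projection_onto smul P (A m)"
  shows "norm ((id_blinfun - P) f) \<le> (1 + norm P) * approx_error A m f"
proof -
  have idem: "P (P x) = P x" for x
    using assms by (metis projection_onto_def blinfun_apply_blinfun_compose)
  have range: "range (blinfun_apply P) = A m"
    using assms by (simp add: projection_onto_def)
  have pos: "0 < 1 + norm P"
    by (simp add: add_pos_nonneg)
  have "norm ((id_blinfun - P) f) / (1 + norm P) \<le> approx_error A m f"
    unfolding approx_error_def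
  proof (rule cINF_greatest)
    show "A m \<noteq> {}" using range by auto
    fix a assume "a \<in> A m"
    then have "P a = a"
      using idem range by (metis imageE)
    then have "(id_blinfun - P) f = (f - a) - P (f - a)"
      by (simp add: minus_blinfun.rep_eq blinfun.diff_right)
    also have "norm \<dots> \<le> (1 + norm P) * norm (f - a)"
      using norm_triangle_ineq4[of "f - a" "P (f - a)"] norm_blinfun[of P "f - a"]
      by (simp add: algebra_simps)
    finally show "norm ((id_blinfun - P) f) / (1 + norm P) \<le> norm (f - a)"
      using pos by (simp add: field_simps)
  qed
  then show ?thesis
    using pos by (simp add: field_simps)
qed

theorem theorem7p2:
  fixes smul :: "'k::real_normed_field \<Rightarrow> 'a::banach \<Rightarrow> 'a"
    and A :: "nat \<Rightarrow> 'a set"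
    and P :: "nat \<Rightarrow> 'a \<Rightarrow>\<^sub>L 'a"
    and n :: "nat \<Rightarrow> nat"
    and r :: real and q :: ennreal
  assumes "approximant_subspaces smul A"
    and "r > 0" and "1 \<le> q"
    and "\<And>j. n j = vector_space.dim smul (A j)"
    and "\<And>j. j \<ge> 1 \<Longrightarrow> projection_onto smul (P j) (A j)"
    and "bdd_above ((\<lambda>j. norm (P j)) ` {1..})"
    and "quasigeometric n"
  shows "(\<exists>c>0. \<forall>j\<ge>1. \<forall>f\<in>approx_space A r q.
            norm ((id_blinfun - P (n j)) f)
              \<le> c * real (n j) powr (- r) * enn2real (approx_norm A r q f))
       \<and> (\<exists>c>0. \<forall>j\<ge>1. \<forall>\<nu>\<in>dual_space smul. \<forall>f\<in>approx_space A r q.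
            norm ((id_blinfun - banach_transpose (P (n j))) \<nu> f)
              \<le> c * real (n j) powr (- r) * norm \<nu> * enn2real (approx_norm A r q f))"
proof -
  interpret approximant_subspaces smul A by fact
  have mono: "mono A"
    by (simp add: mono_iff_le_Suc A_Suc)
  have ne: "A 0 \<noteq> {}"
    by (simp add: A_0)
  obtain C where C: "\<And>m. m \<ge> 1 \<Longrightarrow> norm (P m) \<le> C"
    using assms(6) by (auto simp: bdd_above_def)
  have C0: "0 \<le> C"
    using C[of 1] norm_ge_zero[of "P 1"] by linarith
  define c where "c = (1 + C) * 2 powr (1 + r)"
  have c: "c > 0"
    using C0 by (simp add: c_def)
  have primal: "norm ((id_blinfun - P (n j)) f)
      \<le> c * real (n j) powr (- r) * enn2real (approx_norm A r q f)"
    if j: "j \<ge> 1" and f: "f \<in> approx_space A r q" for j f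
  proof -
    let ?N = "enn2real (approx_norm A r q f)"
    have m: "n j \<ge> 1"
      using assms(7) j by (auto simp: quasigeometric_def Suc_le_eq)
    have E0: "0 \<le> approx_error A (n j) f"
      using monoD[OF mono, of 0 "n j"] ne by (intro approx_error_nonneg) auto
    have "real (n j) powr r * approx_error A (n j) f
        \<le> real (Suc (n j)) powr r * approx_error A (n j) f"
      using E0 assms(2) by (intro mult_right_mono powr_mono2) auto
    also have "\<dots> \<le> 2 powr (1 + r) * ?N"
      using mono ne assms(2,3) f by (intro approx_error_decay) auto
    finally have decay: "approx_error A (n j) f \<le> 2 powr (1 + r) * real (n j) powr (- r) * ?N"
      using m by (simp add: powr_minus field_simps)
    have "norm ((id_blinfun - P (n j)) f) \<le> (1 + norm (P (n j))) * approx_error A (n j) f"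
      using assms(5)[OF m] by (rule projection_error_le_approx_error)
    also have "\<dots> \<le> (1 + C) * (2 powr (1 + r) * real (n j) powr (- r) * ?N)"
      using C[OF m] C0 E0 decay by (intro mult_mono) auto
    finally show ?thesis
      by (simp add: c_def mult_ac)
  qed
  have dual: "norm ((id_blinfun - banach_transpose (P (n j))) \<nu> f)
      \<le> c * real (n j) powr (- r) * norm \<nu> * enn2real (approx_norm A r q f)"
    if j: "j \<ge> 1" and f: "f \<in> approx_space A r q" for j f and \<nu> :: "'a \<Rightarrow>\<^sub>L 'k"
  proof -
    have "(id_blinfun - banach_transpose (P (n j))) \<nu> f = \<nu> ((id_blinfun - P (n j)) f)"
      by (simp add: minus_blinfun.rep_eq banach_transpose_apply blinfun.diff_right)
    also have "norm \<dots> \<le> norm \<nu> * norm ((id_blinfun - P (n j)) f)"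
      by (rule norm_blinfun)
    also have "\<dots> \<le> norm \<nu> * (c * real (n j) powr (- r) * enn2real (approx_norm A r q f))"
      using primal[OF j f] by (rule mult_left_mono) simp
    finally show ?thesis
      by (simp add: mult_ac)
  qed
  show ?thesis
    using c primal dual by blast
qed

end
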